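(* Let $G$ be a three-dimensional Lie group with a bi-invariant metric $\langle\,,\rangle$, and let $\alpha: I\subset\mathbb{R}\to G$ be a regular curve parametrized by arc length $s$, with Frenet vector fields $\{T,N,B\}$ and curvatures $\varkappa,\tau$. Put $\tau_G=\frac12\langle[T,N],B\rangle$. If the two-component spinor $\phi$ along $\alpha$ represents the triad $\{N,B,T\}$, then the Frenet equations $$\frac{dT}{ds}=\varkappa N,\qquad \frac{dN}{ds}=-\varkappa T+(\tau-\tau_G)B,\qquad \frac{dB}{ds}=-(\tau-\tau_G)N$$ are equivalent to the single spinor equation $$\frac{d\phi}{ds}=-i\,\frac{\tau-\tau_G}{2}\,\phi+\frac{\varkappa}{2}\,\widehat{\phi}.$$
   Context: Let $\mathfrak g$ be the Lie algebra of $G$ (left-invariant vector fields) and $D$ the Levi-Civita connection of the bi-invariant metric, so that $D_XY=\frac12[X,Y]$ for $X,Y\in\mathfrak g$. Fix an oriented orthonormal basis $\{X_1,X_2,X_3\}$ of $\mathfrak g$. A vector field along $\alpha$ is written $W=\sum_i w_iX_i$ with smooth functions $w_i:I\to\mathbb R$, and is identified with $(w_1,w_2,w_3)\in\mathbb R^3$. The bracket of two such fields is taken pointwise, $[W,Z]=\sum_{i,j}w_iz_j[X_i,X_j]$. The notation $\frac{dW}{ds}=\dot W=\sum_i\dot w_iX_i$ means the componentwise derivative; the covariant derivative is $D_{\alpha'}W=\dot W+\frac12[T,W]$, where $T=\alpha'$. The Frenet apparatus $(T,N,B,\varkappa,\tau)$ of the arc-length curve $\alpha$ consists of $T=\alpha'$,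 the orthonormal, positively oriented frame $\{T,N,B\}$ and the curvatures $\varkappa=\|\dot T\|$ (nonzero, so that the frame is defined) and $\tau$, for which $D_TT=\varkappa N$, $D_TN=-\varkappa T+\tau B$, $D_TB=-\tau N$. A spinor is a column $\phi=\begin{pmatrix}\phi_1\\ \phi_2\end{pmatrix}\in\mathbb C^2$; its mate is $\widehat\phi=\begin{pmatrix}-\overline{\phi_2}\\ \overline{\phi_1}\end{pmatrix}$. Let $\sigma=(\sigma_1,\sigma_2,\sigma_3)$ with $\sigma_1=\begin{pmatrix}1&0\\0&-1\end{pmatrix}$, $\sigma_2=\begin{pmatrix}i&0\\0&i\end{pmatrix}$, $\sigma_3=\begin{pmatrix}0&-1\\-1&0\end{pmatrix}$, and for spinors $\psi,\phi$ let $\psi^t\sigma\phi=(\psi^t\sigma_1\phi,\psi^t\sigma_2\phi,\psi^t\sigma_3\phi)\in\mathbb C^3$. A spinor $\phi$ along $\alpha$ (a differentiable function $I\to\mathbb C^2$) represents the triad $\{N,B,T\}$ if at each point $N+iB=\phi^t\sigma\phi$ and $T=-\widehat\phi^{\,t}\sigma\phi$, with $\overline{\phi}^{\,t}\phi=1$. Such a spinor is determined up to sign. *)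

theory Defs
  imports "HOL-Analysis.Analysis"
begin

section \<open>Smooth maps and manifolds\<close>

text \<open>Derivatives are taken within \<open>S\<close>; the notion is meant for sets \<open>S\<close> in which they are
  unique, and is used only for open sets and for relatively open subsets of a nondegenerate
  real interval.\<close>

primrec Ck_on :: "nat \<Rightarrow> 'a::real_normed_vector set \<Rightarrow> ('a \<Rightarrow> 'b::real_normed_vector) \<Rightarrow> bool" where
  "Ck_on 0 S f \<longleftrightarrow> continuous_on S f"
| "Ck_on (Suc n) S f \<longleftrightarrow>
     f differentiable_on S \<and> (\<forall>v. Ck_on n S (\<lambda>x. frechet_derivative f (at x within S) v))"

definition smooth_on :: "'a::real_normed_vector set \<Rightarrow> ('a \<Rightarrow> 'b::real_normed_vector) \<Rightarrow> bool" where
  "smooth_on S f \<longleftrightarrow> (\<forall>n. Ck_on n S f)"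

text \<open>A chart is a pair of its domain and its coordinate map; coordinate maps are irrelevant
  outside their domains.\<close>

type_synonym ('m, 'e) atlas = "('m set \<times> ('m \<Rightarrow> 'e)) set"

definition smooth_atlas :: "('m::topological_space, 'e::euclidean_space) atlas \<Rightarrow> bool" where
  "smooth_atlas A \<longleftrightarrow>
     (\<forall>(U, h)\<in>A. open U \<and> open (h ` U) \<and> homeomorphism U (h ` U) h (inv_into U h)) \<and>
     \<Union> (fst ` A) = UNIV \<and>
     (\<forall>(U, h)\<in>A. \<forall>(V, k)\<in>A. smooth_on (h ` (U \<inter> V)) (k \<circ> inv_into U h))"

definition smooth_map ::
  "('m::topological_space, 'e::euclidean_space) atlas \<Rightarrow>
   ('n::topological_space, 'f::euclidean_space) atlas \<Rightarrow> ('m \<Rightarrow> 'n) \<Rightarrow> bool" where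
  "smooth_map A B F \<longleftrightarrow>
     continuous_on UNIV F \<and>
     (\<forall>(U, h)\<in>A. \<forall>(V, k)\<in>B. smooth_on (h ` (U \<inter> F -` V)) (k \<circ> F \<circ> inv_into U h))"

definition smooth_fun :: "('m::topological_space, 'e::euclidean_space) atlas \<Rightarrow> ('m \<Rightarrow> real) \<Rightarrow> bool" where
  "smooth_fun A f \<longleftrightarrow> smooth_map A {(UNIV, id)} f"

definition prod_atlas :: "('m, 'e) atlas \<Rightarrow> ('n, 'f) atlas \<Rightarrow> ('m \<times> 'n, 'e \<times> 'f) atlas" where
  "prod_atlas A B = {(U \<times> V, map_prod h k) | U h V k. (U, h) \<in> A \<and> (V, k) \<in> B}"

definition smooth_curve ::
  "('m::topological_space, 'e::euclidean_space) atlas \<Rightarrow> real set \<Rightarrow> (real \<Rightarrow> 'm) \<Rightarrow> bool" where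
  "smooth_curve A I \<alpha> \<longleftrightarrow>
     continuous_on I \<alpha> \<and> (\<forall>(U, h)\<in>A. smooth_on (I \<inter> \<alpha> -` U) (h \<circ> \<alpha>))"


section \<open>Tangent vectors and vector fields\<close>

text \<open>Tangent vectors at \<open>p\<close> are the derivations at \<open>p\<close> of the algebra of smooth functions, and
  vector fields are the derivations of that algebra. On functions that are not smooth both are
  set to zero, so that two of them are equal in HOL exactly when they agree on smooth functions.\<close>

type_synonym 'm tangent = "('m \<Rightarrow> real) \<Rightarrow> real"
type_synonym 'm vfield = "('m \<Rightarrow> real) \<Rightarrow> 'm \<Rightarrow> real"

definition tangent_space ::
  "('m::topological_space, 'e::euclidean_space) atlas \<Rightarrow> 'm \<Rightarrow> 'm tangent set" where
  "tangent_space A p = {v.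
     (\<forall>f. \<not> smooth_fun A f \<longrightarrow> v f = 0) \<and>
     (\<forall>f h. smooth_fun A f \<longrightarrow> smooth_fun A h \<longrightarrow>
        v (\<lambda>q. f q + h q) = v f + v h \<and>
        v (\<lambda>q. f q * h q) = f p * v h + h p * v f) \<and>
     (\<forall>f c. smooth_fun A f \<longrightarrow> v (\<lambda>q. c * f q) = c * v f)}"

definition vf_at :: "'m vfield \<Rightarrow> 'm \<Rightarrow> 'm tangent" where
  "vf_at X p = (\<lambda>f. X f p)"

definition vector_field ::
  "('m::topological_space, 'e::euclidean_space) atlas \<Rightarrow> 'm vfield \<Rightarrow> bool" where
  "vector_field A X \<longleftrightarrow>
     (\<forall>p. vf_at X p \<in> tangent_space A p) \<and> (\<forall>f. smooth_fun A f \<longrightarrow> smooth_fun A (X f))"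

definition vf_add :: "'m vfield \<Rightarrow> 'm vfield \<Rightarrow> 'm vfield" where
  "vf_add X Y = (\<lambda>f p. X f p + Y f p)"

definition vf_scale :: "('m \<Rightarrow> real) \<Rightarrow> 'm vfield \<Rightarrow> 'm vfield" where
  "vf_scale u X = (\<lambda>f p. u p * X f p)"

definition lie_bracket :: "'m vfield \<Rightarrow> 'm vfield \<Rightarrow> 'm vfield" where
  "lie_bracket X Y = (\<lambda>f p. X (Y f) p - Y (X f) p)"

definition pushforward :: "('m \<Rightarrow> 'n) \<Rightarrow> 'm tangent \<Rightarrow> 'n tangent" where
  "pushforward F v = (\<lambda>f. v (f \<circ> F))"

definition velocity ::
  "('m::topological_space, 'e::euclidean_space) atlas \<Rightarrow> real set \<Rightarrow> (real \<Rightarrow> 'm) \<Rightarrow> real \<Rightarrow> 'm tangent" where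
  "velocity A I \<alpha> s =
     (\<lambda>f. if smooth_fun A f then vector_derivative (f \<circ> \<alpha>) (at s within I) else 0)"


section \<open>Riemannian metrics and the Levi-Civita connection\<close>

type_synonym 'm metric_tensor = "'m \<Rightarrow> 'm tangent \<Rightarrow> 'm tangent \<Rightarrow> real"

definition riemannian_metric ::
  "('m::topological_space, 'e::euclidean_space) atlas \<Rightarrow> 'm metric_tensor \<Rightarrow> bool" where
  "riemannian_metric A g \<longleftrightarrow>
     (\<forall>p. \<forall>u\<in>tangent_space A p. \<forall>v\<in>tangent_space A p.
        g p u v = g p v u \<and>
        (\<forall>w\<in>tangent_space A p. \<forall>a b. g p (\<lambda>f. a * u f + b * v f) w = a * g p u w + b * g p v w) \<and>
        (u \<noteq> (\<lambda>f. 0) \<longrightarrow> g p u u > 0)) \<and>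
     (\<forall>X Y. vector_field A X \<longrightarrow> vector_field A Y \<longrightarrow>
        smooth_fun A (\<lambda>p. g p (vf_at X p) (vf_at Y p)))"

definition levi_civita ::
  "('m::topological_space, 'e::euclidean_space) atlas \<Rightarrow> 'm metric_tensor \<Rightarrow>
   ('m vfield \<Rightarrow> 'm vfield \<Rightarrow> 'm vfield) \<Rightarrow> bool" where
  "levi_civita A g D \<longleftrightarrow>
     (\<forall>X Y. vector_field A X \<longrightarrow> vector_field A Y \<longrightarrow>
        vector_field A (D X Y) \<and>
        (\<forall>Z. vector_field A Z \<longrightarrow>
           D (vf_add X Z) Y = vf_add (D X Y) (D Z Y) \<and>
           D X (vf_add Y Z) = vf_add (D X Y) (D X Z)) \<and>
        (\<forall>u. smooth_fun A u \<longrightarrow>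
           D (vf_scale u X) Y = vf_scale u (D X Y) \<and>
           D X (vf_scale u Y) = vf_add (vf_scale (X u) Y) (vf_scale u (D X Y))) \<and>
        D X Y = vf_add (D Y X) (lie_bracket X Y) \<and>
        (\<forall>Z. vector_field A Z \<longrightarrow>
           (\<forall>p. Z (\<lambda>q. g q (vf_at X q) (vf_at Y q)) p =
                 g p (vf_at (D Z X) p) (vf_at Y p) + g p (vf_at X p) (vf_at (D Z Y) p))))"


section \<open>Three-dimensional Lie groups with a bi-invariant metric\<close>

text \<open>The underlying manifold is the whole type \<open>'g\<close>, whose Hausdorff property and second
  countability come from its type classes; the dimension is that of the charts.\<close>

definition lie_group3 ::
  "('g::{t2_space,second_countable_topology}, real^3) atlas \<Rightarrow> ('g \<Rightarrow> 'g \<Rightarrow> 'g) \<Rightarrow> 'g \<Rightarrow> ('g \<Rightarrow> 'g) \<Rightarrow> bool" where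
  "lie_group3 A mul e iv \<longleftrightarrow>
     group mul e iv \<and> smooth_atlas A \<and>
     smooth_map (prod_atlas A A) A (\<lambda>(x, y). mul x y) \<and> smooth_map A A iv"

definition bi_invariant ::
  "('m::topological_space, 'e::euclidean_space) atlas \<Rightarrow> ('m \<Rightarrow> 'm \<Rightarrow> 'm) \<Rightarrow> 'm metric_tensor \<Rightarrow> bool" where
  "bi_invariant A mul g \<longleftrightarrow>
     (\<forall>a p. \<forall>u\<in>tangent_space A p. \<forall>v\<in>tangent_space A p.
        g (mul a p) (pushforward (\<lambda>q. mul a q) u) (pushforward (\<lambda>q. mul a q) v) = g p u v \<and>
        g (mul p a) (pushforward (\<lambda>q. mul q a) u) (pushforward (\<lambda>q. mul q a) v) = g p u v)"

definition lie_algebra ::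
  "('m::topological_space, 'e::euclidean_space) atlas \<Rightarrow> ('m \<Rightarrow> 'm \<Rightarrow> 'm) \<Rightarrow> 'm vfield set" where
  "lie_algebra A mul =
     {X. vector_field A X \<and> (\<forall>a p. pushforward (\<lambda>q. mul a q) (vf_at X p) = vf_at X (mul a p))}"

definition lincomb :: "(3 \<Rightarrow> 'm vfield) \<Rightarrow> real^3 \<Rightarrow> 'm vfield" where
  "lincomb X w = (\<lambda>f p. \<Sum>i\<in>UNIV. w $ i * X i f p)"

definition orthonormal_basis ::
  "('m::topological_space, 'e::euclidean_space) atlas \<Rightarrow> ('m \<Rightarrow> 'm \<Rightarrow> 'm) \<Rightarrow> 'm metric_tensor \<Rightarrow>
   (3 \<Rightarrow> 'm vfield) \<Rightarrow> bool" where
  "orthonormal_basis A mul g X \<longleftrightarrow>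
     (\<forall>i. X i \<in> lie_algebra A mul) \<and>
     (\<forall>Y\<in>lie_algebra A mul. \<exists>w. Y = lincomb X w) \<and>
     (\<forall>i j p. g p (vf_at (X i) p) (vf_at (X j) p) = (if i = j then 1 else 0))"


section \<open>Curves, vector fields along them, and the Frenet apparatus\<close>

text \<open>From here on a vector field along a curve is given by its coefficient function
  \<open>W :: real \<Rightarrow> real^3\<close> with respect to a basis \<open>X\<close> of the Lie algebra; its value as a tangent
  vector is \<open>along X \<alpha> W s\<close>.\<close>

definition along :: "(3 \<Rightarrow> 'm vfield) \<Rightarrow> (real \<Rightarrow> 'm) \<Rightarrow> (real \<Rightarrow> real^3) \<Rightarrow> real \<Rightarrow> 'm tangent" where
  "along X \<alpha> W s = vf_at (lincomb X (W s)) (\<alpha> s)"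

definition bracket_along ::
  "(3 \<Rightarrow> 'm vfield) \<Rightarrow> (real \<Rightarrow> 'm) \<Rightarrow> (real \<Rightarrow> real^3) \<Rightarrow> (real \<Rightarrow> real^3) \<Rightarrow> real \<Rightarrow> 'm tangent" where
  "bracket_along X \<alpha> W Z s =
     (\<lambda>f. \<Sum>i\<in>UNIV. \<Sum>j\<in>UNIV. W s $ i * Z s $ j * lie_bracket (X i) (X j) f (\<alpha> s))"

text \<open>The covariant derivative of \<open>W\<close> along \<open>\<alpha>\<close>, by the Leibniz rule, where \<open>T\<close> is the coefficient
  function of the velocity. Since \<open>D (X i) (X j)\<close> is half the bracket of \<open>X i\<close> and \<open>X j\<close> for the
  Levi-Civita connection of a bi-invariant metric, this is the componentwise derivative of \<open>W\<close>
  plus half the bracket of \<open>T\<close> and \<open>W\<close>.\<close>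

definition cov_deriv ::
  "('m vfield \<Rightarrow> 'm vfield \<Rightarrow> 'm vfield) \<Rightarrow> (3 \<Rightarrow> 'm vfield) \<Rightarrow> real set \<Rightarrow> (real \<Rightarrow> 'm) \<Rightarrow>
   (real \<Rightarrow> real^3) \<Rightarrow> (real \<Rightarrow> real^3) \<Rightarrow> real \<Rightarrow> 'm tangent" where
  "cov_deriv D X I \<alpha> T W s =
     (\<lambda>f. along X \<alpha> (\<lambda>u. vector_derivative W (at u within I)) s f +
          (\<Sum>i\<in>UNIV. \<Sum>j\<in>UNIV. T s $ i * W s $ j * D (X i) (X j) f (\<alpha> s)))"

definition arc_length_curve ::
  "('m::topological_space, 'e::euclidean_space) atlas \<Rightarrow> 'm metric_tensor \<Rightarrow> real set \<Rightarrow> (real \<Rightarrow> 'm) \<Rightarrow> bool" where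
  "arc_length_curve A g I \<alpha> \<longleftrightarrow>
     is_interval I \<and> interior I \<noteq> {} \<and> smooth_curve A I \<alpha> \<and>
     (\<forall>s\<in>I. sqrt (g (\<alpha> s) (velocity A I \<alpha> s) (velocity A I \<alpha> s)) = 1)"

text \<open>The orientation is the one for which the basis \<open>X\<close> is positively oriented.\<close>

definition frenet_apparatus ::
  "('m::topological_space, 'e::euclidean_space) atlas \<Rightarrow> 'm metric_tensor \<Rightarrow>
   ('m vfield \<Rightarrow> 'm vfield \<Rightarrow> 'm vfield) \<Rightarrow> (3 \<Rightarrow> 'm vfield) \<Rightarrow> real set \<Rightarrow> (real \<Rightarrow> 'm) \<Rightarrow>
   (real \<Rightarrow> real^3) \<Rightarrow> (real \<Rightarrow> real^3) \<Rightarrow> (real \<Rightarrow> real^3) \<Rightarrow> (real \<Rightarrow> real) \<Rightarrow> (real \<Rightarrow> real) \<Rightarrow> bool" where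
  "frenet_apparatus A g D X I \<alpha> T N B \<kappa> \<tau> \<longleftrightarrow>
     smooth_on I T \<and> smooth_on I N \<and> smooth_on I B \<and>
     (\<forall>s\<in>I.
        let ip = (\<lambda>W Z. g (\<alpha> s) (along X \<alpha> W s) (along X \<alpha> Z s));
            T' = (\<lambda>u. vector_derivative T (at u within I)) in
        along X \<alpha> T s = velocity A I \<alpha> s \<and>
        ip T T = 1 \<and> ip N N = 1 \<and> ip B B = 1 \<and> ip T N = 0 \<and> ip T B = 0 \<and> ip N B = 0 \<and>
        det (vector [T s, N s, B s] :: real^3^3) > 0 \<and>
        \<kappa> s = sqrt (ip T' T') \<and> \<kappa> s \<noteq> 0 \<and>
        cov_deriv D X I \<alpha> T T s = along X \<alpha> (\<lambda>u. \<kappa> u *\<^sub>R N u) s \<and>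
        cov_deriv D X I \<alpha> T N s = along X \<alpha> (\<lambda>u. - \<kappa> u *\<^sub>R T u + \<tau> u *\<^sub>R B u) s \<and>
        cov_deriv D X I \<alpha> T B s = along X \<alpha> (\<lambda>u. - \<tau> u *\<^sub>R N u) s)"

definition tau_G ::
  "'m metric_tensor \<Rightarrow> (3 \<Rightarrow> 'm vfield) \<Rightarrow> (real \<Rightarrow> 'm) \<Rightarrow>
   (real \<Rightarrow> real^3) \<Rightarrow> (real \<Rightarrow> real^3) \<Rightarrow> (real \<Rightarrow> real^3) \<Rightarrow> real \<Rightarrow> real" where
  "tau_G g X \<alpha> T N B s = 1/2 * g (\<alpha> s) (bracket_along X \<alpha> T N s) (along X \<alpha> B s)"


section \<open>Spinors\<close>

definition mate :: "complex^2 \<Rightarrow> complex^2" where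
  "mate \<phi> = vector [- cnj (\<phi> $ 2), cnj (\<phi> $ 1)]"

definition sigma :: "complex^2^2^3" where
  "sigma = vector
     [vector [vector [1, 0], vector [0, -1]],
      vector [vector [\<i>, 0], vector [0, \<i>]],
      vector [vector [0, -1], vector [-1, 0]]]"

definition spin_form :: "complex^2 \<Rightarrow> complex^2 \<Rightarrow> complex^3" where
  "spin_form \<psi> \<phi> = (\<chi> k. \<Sum>j\<in>UNIV. \<psi> $ j * (sigma $ k *v \<phi>) $ j)"

definition represents_triad :: "complex^2 \<Rightarrow> real^3 \<Rightarrow> real^3 \<Rightarrow> real^3 \<Rightarrow> bool" where
  "represents_triad \<phi> N B T \<longleftrightarrow>
     (\<chi> k. complex_of_real (N $ k) + \<i> * complex_of_real (B $ k)) = spin_form \<phi> \<phi> \<and>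
     (\<chi> k. complex_of_real (T $ k)) = - spin_form (mate \<phi>) \<phi> \<and>
     (\<Sum>j\<in>UNIV. cnj (\<phi> $ j) * \<phi> $ j) = 1"

end

theory Submission
  imports Defs
begin

text \<open>
  Both sides are compared pointwise through the derivative \<open>v\<close> of \<open>\<phi>\<close>. The form
  \<open>\<psi>\<^sup>t\<sigma>\<eta>\<close> is bilinear and symmetric, so differentiating \<open>N + iB = \<phi>\<^sup>t\<sigma>\<phi>\<close> gives
  \<open>N' + iB' = 2 \<phi>\<^sup>t\<sigma>v\<close>, and similarly for \<open>T\<close>.

  If \<open>v = -i(t/2) \<phi> + (k/2) mate \<phi>\<close>, then
  \<open>2 \<phi>\<^sup>t\<sigma>v = -it(N + iB) - kT\<close>, whose real and imaginary parts are the last two Frenet equations,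
  and the first follows in the same way from the conjugation rules for mates
  (\<open>frenet_iff_spinor_pointwise\<close>). Conversely, the last two Frenet equations say that
  \<open>\<phi>\<^sup>t\<sigma>v = \<phi>\<^sup>t\<sigma>w\<close> for the right-hand side \<open>w\<close> of the spinor equation, and for a nonzero spinor
  \<open>\<phi>\<close> the map \<open>v \<mapsto> \<phi>\<^sup>t\<sigma>v\<close> is injective (\<open>spin_form_cancel\<close>), so \<open>v = w\<close>.

  Comparing \<open>N' + iB'\<close> with the Frenet equations needs derivatives within \<open>I\<close> to be unique, which
  holds because \<open>I\<close> is a nondegenerate interval. The coefficients \<open>k = \<kappa>\<close> and \<open>t = \<tau> - \<tau>\<^sub>G\<close> can be
  arbitrary real numbers.
\<close>

lemma mate_nth [simp]: "mate \<phi> $ 1 = - cnj (\<phi> $ 2)" "mate \<phi> $ 2 = cnj (\<phi> $ 1)"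
  by (simp_all add: mate_def)

lemma mate_mate: "mate (mate \<phi>) = - \<phi>"
  by (simp add: vec_eq_iff forall_2)

lemma mate_add: "mate (\<phi> + \<psi>) = mate \<phi> + mate \<psi>"
  by (simp add: vec_eq_iff forall_2)

lemma mate_smult: "mate (c *s \<phi>) = cnj c *s mate \<phi>"
  by (simp add: vec_eq_iff forall_2)

lemma bounded_linear_mate: "bounded_linear mate"
  unfolding linear_conv_bounded_linear[symmetric]
  by (rule linearI) (simp_all add: vec_eq_iff forall_2 complex_eq_iff)

lemma spin_form_nth [simp]:
  "spin_form \<psi> \<phi> $ 1 = \<psi> $ 1 * \<phi> $ 1 - \<psi> $ 2 * \<phi> $ 2"
  "spin_form \<psi> \<phi> $ 2 = \<i> * (\<psi> $ 1 * \<phi> $ 1 + \<psi> $ 2 * \<phi> $ 2)"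
  "spin_form \<psi> \<phi> $ 3 = - (\<psi> $ 1 * \<phi> $ 2 + \<psi> $ 2 * \<phi> $ 1)"
  by (simp_all add: spin_form_def sigma_def sum_2 matrix_vector_mult_def algebra_simps)

lemma spin_form_commute: "spin_form \<psi> \<phi> = spin_form \<phi> \<psi>"
  by (simp add: vec_eq_iff forall_3 algebra_simps)

lemma spin_form_add_right: "spin_form \<psi> (\<phi> + \<eta>) = spin_form \<psi> \<phi> + spin_form \<psi> \<eta>"
  by (simp add: vec_eq_iff forall_3 algebra_simps)

lemma spin_form_smult_right: "spin_form \<psi> (c *s \<phi>) = c *s spin_form \<psi> \<phi>"
  by (simp add: vec_eq_iff forall_3 algebra_simps)

lemma spin_form_uminus_right: "spin_form \<psi> (- \<phi>) = - spin_form \<psi> \<phi>"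
  by (simp add: vec_eq_iff forall_3) (simp add: algebra_simps)

lemma spin_form_mate_mate:
  "spin_form (mate \<phi>) (mate \<phi>) = - (\<chi> k. cnj (spin_form \<phi> \<phi> $ k))"
  by (simp add: vec_eq_iff forall_3 algebra_simps)

lemma bounded_bilinear_spin_form: "bounded_bilinear spin_form"
  unfolding bilinear_conv_bounded_bilinear[symmetric] bilinear_def
  by (auto intro!: linearI simp: vec_eq_iff forall_3 algebra_simps)

lemma spin_form_cancel:
  assumes "\<phi> \<noteq> 0" and "spin_form \<phi> v = spin_form \<phi> w"
  shows "v = w"
proof -
  define d where "d = v - w"
  have zero: "spin_form \<phi> d $ j = 0" for j
    using assms(2) by (simp add: d_def bounded_bilinear.diff_right[OF bounded_bilinear_spin_form])
  have eq: "\<phi> $ 1 * d $ 1 = \<phi> $ 2 * d $ 2"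
    using zero[of 1] by simp
  have sum: "\<phi> $ 1 * d $ 1 + \<phi> $ 2 * d $ 2 = 0"
    using zero[of 2] by simp
  have cross: "\<phi> $ 1 * d $ 2 + \<phi> $ 2 * d $ 1 = 0"
    using zero[of 3] by (simp only: spin_form_nth neg_equal_0_iff_equal)
  have "2 * (\<phi> $ 2 * d $ 2) = 0"
    using sum unfolding eq mult_2 .
  then have "\<phi> $ 2 * d $ 2 = 0"
    by simp
  moreover from this eq have "\<phi> $ 1 * d $ 1 = 0"
    by simp
  ultimately have "d = 0"
    using cross assms(1) by (auto simp: vec_eq_iff forall_2)
  then show ?thesis
    by (simp add: d_def)
qed

lemma bounded_linear_Re_vec: "bounded_linear (\<lambda>z::complex^'n. \<chi> k. Re (z $ k))"
  unfolding linear_conv_bounded_linear[symmetric]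
  by (rule linearI) (simp_all add: vec_eq_iff)

lemma bounded_linear_Im_vec: "bounded_linear (\<lambda>z::complex^'n. \<chi> k. Im (z $ k))"
  unfolding linear_conv_bounded_linear[symmetric]
  by (rule linearI) (simp_all add: vec_eq_iff)

lemma represents_triad_nonzero: "represents_triad \<phi> N B T \<Longrightarrow> \<phi> \<noteq> 0"
  by (auto simp: represents_triad_def)

lemma represents_triad_components:
  assumes "represents_triad \<phi> N B T"
  shows "N = (\<chi> k. Re (spin_form \<phi> \<phi> $ k))"
    and "B = (\<chi> k. Im (spin_form \<phi> \<phi> $ k))"
    and "T = (\<chi> k. Re ((- spin_form (mate \<phi>) \<phi>) $ k))"
  using assms unfolding represents_triad_def by (auto simp: vec_eq_iff complex_eq_iff)

lemma triad_has_vector_derivative: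
  assumes \<phi>: "(\<phi> has_vector_derivative v) (at s within I)"
    and "s \<in> I" and rep: "\<And>u. u \<in> I \<Longrightarrow> represents_triad (\<phi> u) (N u) (B u) (T u)"
  shows "(N has_vector_derivative (\<chi> k. Re ((2 *s spin_form (\<phi> s) v) $ k))) (at s within I)"
    and "(B has_vector_derivative (\<chi> k. Im ((2 *s spin_form (\<phi> s) v) $ k))) (at s within I)"
    and "(T has_vector_derivative
          (\<chi> k. Re ((- (spin_form (mate (\<phi> s)) v + spin_form (mate v) (\<phi> s))) $ k))) (at s within I)"
proof -
  have "((\<lambda>u. spin_form (\<phi> u) (\<phi> u)) has_vector_derivative
          spin_form (\<phi> s) v + spin_form v (\<phi> s)) (at s within I)"
    by (rule bounded_bilinear.has_vector_derivative[OF bounded_bilinear_spin_form \<phi> \<phi>])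
  moreover have "spin_form (\<phi> s) v + spin_form v (\<phi> s) = 2 *s spin_form (\<phi> s) v"
    by (simp add: spin_form_commute[of v] vec_eq_iff)
  ultimately have d: "((\<lambda>u. spin_form (\<phi> u) (\<phi> u)) has_vector_derivative
      2 *s spin_form (\<phi> s) v) (at s within I)"
    by simp
  show "(N has_vector_derivative (\<chi> k. Re ((2 *s spin_form (\<phi> s) v) $ k))) (at s within I)"
    by (rule has_vector_derivative_transform[OF \<open>s \<in> I\<close> _
          bounded_linear.has_vector_derivative[OF bounded_linear_Re_vec d]])
      (rule represents_triad_components(1)[OF rep])
  show "(B has_vector_derivative (\<chi> k. Im ((2 *s spin_form (\<phi> s) v) $ k))) (at s within I)"
    by (rule has_vector_derivative_transform[OF \<open>s \<in> I\<close> _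
          bounded_linear.has_vector_derivative[OF bounded_linear_Im_vec d]])
      (rule represents_triad_components(2)[OF rep])
  have "((\<lambda>u. - spin_form (mate (\<phi> u)) (\<phi> u)) has_vector_derivative
          - (spin_form (mate (\<phi> s)) v + spin_form (mate v) (\<phi> s))) (at s within I)"
    by (intro has_vector_derivative_minus \<phi>
        bounded_bilinear.has_vector_derivative[OF bounded_bilinear_spin_form]
        bounded_linear.has_vector_derivative[OF bounded_linear_mate])
  from bounded_linear.has_vector_derivative[OF bounded_linear_Re_vec this]
  show "(T has_vector_derivative
          (\<chi> k. Re ((- (spin_form (mate (\<phi> s)) v + spin_form (mate v) (\<phi> s))) $ k))) (at s within I)"
    by (rule has_vector_derivative_transform[OF \<open>s \<in> I\<close>, rotated])
      (rule represents_triad_components(3)[OF rep])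
qed

text \<open>The complex form of the three Frenet equations for a spinor moving with velocity
  \<open>-i(t/2) \<phi> + (k/2) mate \<phi>\<close>.\<close>

lemma spin_form_spinor_velocity:
  fixes \<phi> :: "complex^2" and k t :: real
  defines "w \<equiv> (- \<i> * complex_of_real (t / 2)) *s \<phi> + complex_of_real (k / 2) *s mate \<phi>"
  assumes rep: "represents_triad \<phi> N B T"
  shows "2 *s spin_form \<phi> w =
      (\<chi> j. complex_of_real ((- k *\<^sub>R T + t *\<^sub>R B) $ j) + \<i> * complex_of_real ((- t *\<^sub>R N) $ j))"
    and "- (spin_form (mate \<phi>) w + spin_form (mate w) \<phi>) =
      (\<chi> j. complex_of_real ((k *\<^sub>R N) $ j))"
proof -
  have NB: "spin_form \<phi> \<phi> = (\<chi> j. complex_of_real (N $ j) + \<i> * complex_of_real (B $ j))"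
    and T: "spin_form (mate \<phi>) \<phi> = - (\<chi> j. complex_of_real (T $ j))"
    using rep by (auto simp: represents_triad_def)
  show "2 *s spin_form \<phi> w =
      (\<chi> j. complex_of_real ((- k *\<^sub>R T + t *\<^sub>R B) $ j) + \<i> * complex_of_real ((- t *\<^sub>R N) $ j))"
    unfolding w_def spin_form_add_right spin_form_smult_right spin_form_commute[of \<phi> "mate \<phi>"] NB T
    by (simp add: vec_eq_iff complex_eq_iff)
  have mate_w: "mate w = (\<i> * complex_of_real (t / 2)) *s mate \<phi> + complex_of_real (k / 2) *s (- \<phi>)"
    by (simp only: w_def mate_add mate_smult mate_mate) simp
  show "- (spin_form (mate \<phi>) w + spin_form (mate w) \<phi>) =
      (\<chi> j. complex_of_real ((k *\<^sub>R N) $ j))"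
    unfolding mate_w spin_form_commute[of _ \<phi>]
    unfolding w_def spin_form_add_right spin_form_smult_right spin_form_uminus_right
      spin_form_mate_mate spin_form_commute[of \<phi> "mate \<phi>"] NB T
    by (simp add: vec_eq_iff complex_eq_iff)
qed

lemma frenet_iff_spinor_pointwise:
  fixes k t :: real
  assumes \<phi>: "(\<phi> has_vector_derivative v) (at s within I)"
    and s: "s \<in> I" and limit: "at s within I \<noteq> bot"
    and rep: "\<And>u. u \<in> I \<Longrightarrow> represents_triad (\<phi> u) (N u) (B u) (T u)"
  shows "(T has_vector_derivative k *\<^sub>R N s) (at s within I) \<and>
      (N has_vector_derivative - k *\<^sub>R T s + t *\<^sub>R B s) (at s within I) \<and>
      (B has_vector_derivative - t *\<^sub>R N s) (at s within I)
    \<longleftrightarrow>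
      (\<phi> has_vector_derivative
        (- \<i> * complex_of_real (t / 2)) *s \<phi> s + complex_of_real (k / 2) *s mate (\<phi> s)) (at s within I)"
    (is "?T \<and> ?N \<and> ?B \<longleftrightarrow> (\<phi> has_vector_derivative ?w) _")
proof
  have Re_parts: "(\<chi> j. Re ((\<chi> j. complex_of_real (a $ j) + \<i> * complex_of_real (b $ j)) $ j)) = a"
      "(\<chi> j. Re ((\<chi> j. complex_of_real (a $ j)) $ j)) = a"
    and Im_parts:
      "(\<chi> j. Im ((\<chi> j. complex_of_real (a $ j) + \<i> * complex_of_real (b $ j)) $ j)) = b"
    for a b :: "real^3"
    by (simp_all add: vec_eq_iff)
  note vel = spin_form_spinor_velocity[OF rep[OF s], where k = k and t = t]
  show "?T \<and> ?N \<and> ?B" if w: "(\<phi> has_vector_derivative ?w) (at s within I)"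
    using triad_has_vector_derivative[OF w s rep] unfolding vel Re_parts Im_parts by blast
  assume "?T \<and> ?N \<and> ?B"
  then have N: ?N and B: ?B
    by auto
  have "(\<chi> j. Re ((2 *s spin_form (\<phi> s) v) $ j)) = - k *\<^sub>R T s + t *\<^sub>R B s"
    by (rule vector_derivative_unique_within
        [OF limit triad_has_vector_derivative(1)[OF \<phi> s rep] N])
  moreover have "(\<chi> j. Im ((2 *s spin_form (\<phi> s) v) $ j)) = - t *\<^sub>R N s"
    by (rule vector_derivative_unique_within
        [OF limit triad_has_vector_derivative(2)[OF \<phi> s rep] B])
  ultimately have "2 *s spin_form (\<phi> s) v = 2 *s spin_form (\<phi> s) ?w"
    unfolding vel by (simp add: vec_eq_iff complex_eq_iff)
  then have "spin_form (\<phi> s) v = spin_form (\<phi> s) ?w"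
    by (simp add: vec_eq_iff)
  then have "v = ?w"
    by (rule spin_form_cancel[OF represents_triad_nonzero[OF rep[OF s]]])
  with \<phi> show "(\<phi> has_vector_derivative ?w) (at s within I)"
    by simp
qed

lemma at_within_interval_neq_bot:
  fixes I :: "real set"
  assumes "is_interval I" "interior I \<noteq> {}" "s \<in> I"
  shows "at s within I \<noteq> bot"
proof -
  have "I \<noteq> {x}" for x
    using assms(2) by auto
  moreover have "connected I"
    using assms(1) by (rule is_interval_connected)
  ultimately have "s islimpt I"
    using assms(3) by (intro connected_imp_perfect)
  then show ?thesis
    by (simp add: trivial_limit_within)
qed

theorem theorem3p1:
  fixes A :: "('g::{t2_space,second_countable_topology}, real^3) atlas"
    and mul :: "'g \<Rightarrow> 'g \<Rightarrow> 'g" and e :: 'g and iv :: "'g \<Rightarrow> 'g"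
    and g :: "'g metric_tensor"
    and D :: "'g vfield \<Rightarrow> 'g vfield \<Rightarrow> 'g vfield"
    and X :: "3 \<Rightarrow> 'g vfield"
    and I :: "real set" and \<alpha> :: "real \<Rightarrow> 'g"
    and T N B :: "real \<Rightarrow> real^3" and \<kappa> \<tau> :: "real \<Rightarrow> real"
    and \<phi> :: "real \<Rightarrow> complex^2"
  assumes "lie_group3 A mul e iv"
    and "riemannian_metric A g" and "bi_invariant A mul g"
    and "levi_civita A g D"
    and "orthonormal_basis A mul g X"
    and "arc_length_curve A g I \<alpha>"
    and "frenet_apparatus A g D X I \<alpha> T N B \<kappa> \<tau>"
    and "\<phi> differentiable_on I"
    and "\<forall>s\<in>I. represents_triad (\<phi> s) (N s) (B s) (T s)"
  shows "(\<forall>s\<in>I.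
            (T has_vector_derivative \<kappa> s *\<^sub>R N s) (at s within I) \<and>
            (N has_vector_derivative
               - \<kappa> s *\<^sub>R T s + (\<tau> s - tau_G g X \<alpha> T N B s) *\<^sub>R B s) (at s within I) \<and>
            (B has_vector_derivative
               - (\<tau> s - tau_G g X \<alpha> T N B s) *\<^sub>R N s) (at s within I))
         \<longleftrightarrow>
         (\<forall>s\<in>I.
            (\<phi> has_vector_derivative
               (- \<i> * complex_of_real ((\<tau> s - tau_G g X \<alpha> T N B s) / 2)) *s \<phi> s
               + complex_of_real (\<kappa> s / 2) *s mate (\<phi> s)) (at s within I))"
proof -
  have limit: "at s within I \<noteq> bot" if "s \<in> I" for s
    using assms(6) that unfolding arc_length_curve_def
    by (intro at_within_interval_neq_bot) simp_all
  have deriv: "(\<phi> has_vector_derivative vector_derivative \<phi> (at s within I)) (at s within I)"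
    if "s \<in> I" for s
    using assms(8) that by (simp add: differentiable_on_def vector_derivative_works)
  have rep: "represents_triad (\<phi> s) (N s) (B s) (T s)" if "s \<in> I" for s
    using assms(9) that by blast
  show ?thesis
    by (intro ball_cong refl frenet_iff_spinor_pointwise[OF deriv _ limit rep])
qed

end
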